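(* Consider a sequence of models of the following form, in an asymptotic regime where $M,N,m^*,n^*\to\infty$ and $\max(m^*,n^* )/\min(M,N)\to 0$, with $\theta>0$ allowed to vary with $(M,N,m^*,n^* )$: one observes an $M\times N$ matrix $\mathbf{X}=(X_{ij})$ with $X_{ij}=\theta\,1_{\{(i,j)\in I^*\times J^*\}}+\varepsilon_{ij}$, where the $\varepsilon_{ij}$ are i.i.d. standard normal and $I^*\subset[M]$, $J^*\subset[N]$ are index sets with $|I^*|=m^*$, $|J^*|=n^*$. Let $$\lambda_{m,n}=\sqrt{2\log\left[MN\binom{M}{m}\binom{N}{n}\right]},$$ let $C$ be the positive real solution of the equation $$C=2\left(\left[\frac{C}{C-1}\right]^{1.5}+\left[\frac{C}{C-1}\right]^{1.25}\right),$$ and set $$\theta_1=C\max\left\{\sqrt{\frac{\log(M-m^* )+\log m^*}{n^*}},\ \sqrt{\frac{\log(N-n^* )+\log n^*}{m^*}},\ \frac{\lambda_{m^*,n^*}}{\sqrt{m^*n^*}}\right\}.$$ If $\liminf \theta/\theta_1>1$, then the estimator $$\Phi(\mathbf{X})=\operatorname*{arg\,max}_{\emptyset\ne I\subset[M],\ \emptyset\ne J\subset[N]}\left\{\frac{\sum_{(i,j)\in I\times J}X_{ij}}{\sqrt{|I||J|}}-\lambda_{|I|,|J|}\right\}$$ satisfies $\mathbb{P}\big(\Phi(\mathbf{X})=(I^*,J^* )\big)\to 1$.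
   Context: $[M]=\{1,\dots,M\}$ and $|I|$ is the cardinality of $I$. All limits ($\liminf$, $\to$) are along the asymptotic regime described. The estimator $\Phi(\mathbf{X})$ uses no knowledge of $(m^*,n^* )$: the maximization is over all pairs of row and column index sets of all sizes. *)

theory Defs
  imports "HOL-Probability.Probability"
begin

definition scan_penalty :: "nat \<Rightarrow> nat \<Rightarrow> nat \<Rightarrow> nat \<Rightarrow> real" where
  "scan_penalty M N m n =
     sqrt (2 * ln (real M * real N * real (M choose m) * real (N choose n)))"

definition scan_criterion ::
    "nat \<Rightarrow> nat \<Rightarrow> (nat \<times> nat \<Rightarrow> real) \<Rightarrow> nat set \<times> nat set \<Rightarrow> real" where
  "scan_criterion M N X = (\<lambda>(I, J).
     (\<Sum>ij\<in>I \<times> J. X ij) / sqrt (real (card I) * real (card J))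
       - scan_penalty M N (card I) (card J))"

text \<open>If there are several maximizers, \<^const>\<open>arg_max_on\<close> selects one of them by Hilbert choice,
  as a function of the set of maximizers only.\<close>

definition scan_estimator :: "nat \<Rightarrow> nat \<Rightarrow> (nat \<times> nat \<Rightarrow> real) \<Rightarrow> nat set \<times> nat set" where
  "scan_estimator M N X =
     arg_max_on (scan_criterion M N X)
       {(I, J). I \<noteq> {} \<and> I \<subseteq> {1..M} \<and> J \<noteq> {} \<and> J \<subseteq> {1..N}}"

definition planted_matrix ::
    "real \<Rightarrow> nat set \<Rightarrow> nat set \<Rightarrow> (nat \<times> nat \<Rightarrow> real) \<Rightarrow> nat \<times> nat \<Rightarrow> real" where
  "planted_matrix \<theta> I J e = (\<lambda>ij. \<theta> * indicator (I \<times> J) ij + e ij)"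

text \<open>The real powers only make sense when \<open>C / (C - 1) > 0\<close>, which for positive \<open>C\<close>
  means \<open>C > 1\<close>.\<close>

definition is_threshold_const :: "real \<Rightarrow> bool" where
  "is_threshold_const C \<longleftrightarrow>
     C > 1 \<and> C = 2 * ((C / (C - 1)) powr (3/2) + (C / (C - 1)) powr (5/4))"

lemma threshold_const_ex1: "\<exists>!C. is_threshold_const C"
proof (rule ex_ex1I)
  define g where "g C = 2 * ((C / (C - 1)) powr (3/2) + (C / (C - 1)) powr (5/4)) - C" for C :: real
  have "continuous_on {2..10} g"
    unfolding g_def by (intro continuous_intros) auto
  moreover have "g 10 \<le> 0"
  proof -
    have "(10/9 :: real) powr (3/2) \<le> (10/9) powr 2" "(10/9 :: real) powr (5/4) \<le> (10/9) powr 2"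
      by (intro powr_mono; simp)+
    moreover have "(10/9 :: real) powr 2 = 100/81"
      by (simp add: power2_eq_square)
    ultimately show ?thesis unfolding g_def by simp
  qed
  moreover have "0 \<le> g 2"
  proof -
    have "(2 :: real) powr 0 \<le> 2 powr (3/2)" "(2 :: real) powr 0 \<le> 2 powr (5/4)"
      by (intro powr_mono; simp)+
    then show ?thesis unfolding g_def by simp
  qed
  ultimately obtain C where "2 \<le> C" "C \<le> 10" "g C = 0"
    using IVT2'[of g 10 0 2] by auto
  then show "\<exists>C. is_threshold_const C"
    unfolding is_threshold_const_def g_def by (intro exI[of _ C]) auto
next
  have le: "D \<le> C" if "is_threshold_const C" "is_threshold_const D" "C < D" for C D
  proof -
    have 1: "0 \<le> D / (D - 1)" "D / (D - 1) \<le> C / (C - 1)"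
      using that unfolding is_threshold_const_def by (auto simp: field_simps)
    have "(D / (D - 1)) powr (3/2) \<le> (C / (C - 1)) powr (3/2)"
         "(D / (D - 1)) powr (5/4) \<le> (C / (C - 1)) powr (5/4)"
      using 1 by (auto intro!: powr_mono2)
    moreover have "C = 2 * ((C / (C - 1)) powr (3/2) + (C / (C - 1)) powr (5/4))"
         "D = 2 * ((D / (D - 1)) powr (3/2) + (D / (D - 1)) powr (5/4))"
      using that(1,2) unfolding is_threshold_const_def by blast+
    ultimately show ?thesis by argo
  qed
  show "C = D" if "is_threshold_const C" "is_threshold_const D" for C D
    using le[of C D] le[of D C] that by linarith
qed

definition signal_threshold :: "real \<Rightarrow> nat \<Rightarrow> nat \<Rightarrow> nat \<Rightarrow> nat \<Rightarrow> real" where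
  "signal_threshold C M N m n = C *
     Max {sqrt ((ln (real M - real m) + ln (real m)) / real n),
          sqrt ((ln (real N - real n) + ln (real n)) / real m),
          scan_penalty M N m n / sqrt (real m * real n)}"

end

theory Submission imports Defs begin

text \<open>
  Why the estimator succeeds. Let \<open>G = \<theta> \<surd>(mn)\<close> be the strength of the planted block \<open>A \<times> B\<close>,
  and for a competitor \<open>I \<times> J\<close> with \<open>a\<close> rows and \<open>b\<close> columns let
  \<open>\<rho> = |A \<inter> I| |B \<inter> J| / \<surd>(mnab)\<close> be the overlap. The normalized noise sums over the two blocks
  are standard normal with correlation \<open>\<rho>\<close>, and the planted block beats the competitor iff
  \<open>G (1 - \<rho>)\<close> exceeds the noise difference, which has variance \<open>2 (1 - \<rho>)\<close>, plus the penalty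
  difference \<open>\<lambda>\<^bsub>m,n\<^esub> - \<lambda>\<^bsub>a,b\<^esub>\<close>. The equation for \<open>C\<close> forces \<open>C \<ge> 5\<close>, so that
  \<open>G \<ge> 5 r \<lambda>\<^bsub>m,n\<^esub>\<close> for some fixed \<open>r > 1\<close>, and likewise for the other two terms of the threshold.
  Competitors are divided according to \<open>\<rho>\<close>.

  Far competitors, \<open>\<rho> < 4/5\<close>. The penalty makes the union bound over all pairs of index sets work
  (\<open>uniform_noise_bound\<close>): with high probability no block has noise above its own penalty plus one. The noise of
  the planted block alone is of bounded order. As \<open>G (1 - \<rho>) \<ge> G/5 \<ge> r \<lambda>\<^bsub>m,n\<^esub>\<close> and
  \<open>\<lambda>\<^bsub>m,n\<^esub> \<rightarrow> \<infinity>\<close>, the planted block wins.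

  Near competitors, \<open>\<rho> \<ge> 4/5\<close>. Here the exponential Markov inequality is applied to the noise
  difference with the linear tilt \<open>h = G/4\<close>, which gives the exponent
  \<open>(G/4)(\<lambda>\<^bsub>m,n\<^esub> - \<lambda>\<^bsub>a,b\<^esub>) - (3/16) G\<^sup>2 (1 - \<rho>)\<close>. The tilt does not depend on the competitor, so
  everything in sight is additive in rows and columns. With \<open>p\<close> rows missing and \<open>q\<close> rows
  superfluous, \<open>1 - \<rho>\<close> is at least a constant times \<open>(p + q)/m\<close> plus the same for columns
  (\<open>one_minus_overlap_ge\<close>), and the penalty can only drop if rows or columns are lost, by an amount proportional
  to the net loss (\<open>penalty_difference_le\<close>). With the first two terms of the threshold this bounds the
  contribution of the rows by the power \<open>-21/20\<close> of \<open>m\<^sup>p (M - m)\<^sup>q\<close> (\<open>one_sided_exponent_le\<close>,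
  \<open>near_competitor_tail\<close>). There are at most \<open>m\<^sup>p (M - m)\<^sup>q\<close> row sets of this kind; the extra
  \<open>1/20\<close> makes the sum over all competitors vanish in the limit. The sum is evaluated in closed form,
  with the row part \<open>(1 + x)\<^sup>m (1 + y)\<^bsup>M - m\<^esup>\<close> (\<open>sum_subsets_symm_diff_weight\<close>).

  These estimates hold for fixed dimensions (\<open>recovery_probability\<close>); the limit theorem follows by letting
  the three error terms tend to zero.
\<close>

section \<open>Sums over subsets\<close>

text \<open>
  Expand a product over \<open>U\<close>: each element of \<open>A\<close> is either kept (factor \<open>1\<close>) or missed (factor \<open>x\<close>),
  and each element outside \<open>A\<close> is either left out (factor \<open>1\<close>) or added (factor \<open>y\<close>). This replaces
  counting the sets \<open>I\<close> with given numbers of missed and added elements.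
\<close>

lemma sum_subsets_symm_diff_weight:
  fixes x y :: "'b :: comm_semiring_1"
  assumes "finite U" "A \<subseteq> U"
  shows "(\<Sum>I\<in>Pow U. x ^ card (A - I) * y ^ card (I - A)) = (1 + x) ^ card A * (1 + y) ^ card (U - A)"
proof -
  \<comment> \<open>\<open>f\<close> is the factor of an element of the subset, \<open>g\<close> that of an element outside it\<close>
  define f where "f i = (if i \<in> A then 1 else y)" for i
  define g where "g i = (if i \<in> A then x else 1)" for i
  have term_eq: "x ^ card (A - I) * y ^ card (I - A) = prod f I * prod g (U - I)" if "I \<in> Pow U" for I
  proof -
    have fin: "finite I" "finite (U - I)" using that assms(1) by (auto intro: finite_subset)
    have "prod f I = (\<Prod>i\<in>I - A. y)"
      using fin by (intro prod.mono_neutral_cong_right) (auto simp: f_def)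
    moreover have "prod g (U - I) = (\<Prod>i\<in>A - I. x)"
      using fin assms(2) by (intro prod.mono_neutral_cong_right) (auto simp: g_def)
    ultimately show ?thesis by (simp add: mult.commute)
  qed
  have "(\<Sum>I\<in>Pow U. x ^ card (A - I) * y ^ card (I - A)) = (\<Prod>i\<in>U. f i + g i)"
    by (simp add: prod_add[OF assms(1)] term_eq)
  also have "\<dots> = (\<Prod>i\<in>A. f i + g i) * (\<Prod>i\<in>U - A. f i + g i)"
    using prod.subset_diff[OF assms(2,1), of "\<lambda>i. f i + g i"] by (simp add: mult.commute)
  also have "\<dots> = (1 + x) ^ card A * (1 + y) ^ card (U - A)"
    by (simp add: f_def g_def add.commute)
  finally show ?thesis .
qed

text \<open>
  These weights are the row (or column) part of \<open>exp (- \<lambda>\<^sup>2 / 2)\<close>. They form a probability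
  distribution on the nonempty subsets: a uniform size, and then a uniform subset of that size.
\<close>

lemma sum_inverse_binomial_subsets:
  assumes "finite U" "U \<noteq> {}"
  shows "(\<Sum>I\<in>Pow U - {{}}. 1 / (real (card U) * real (card U choose card I))) = 1"
proof -
  let ?n = "card U"
  have n: "?n > 0" using assms by (simp add: card_gt_0_iff)
  have "(\<Sum>I\<in>Pow U - {{}}. 1 / (real ?n * real (?n choose card I)))
      = (\<Sum>k\<in>{1..?n}. \<Sum>I\<in>{I\<in>Pow U - {{}}. card I = k}. 1 / (real ?n * real (?n choose card I)))"
  proof (rule sum.group[symmetric])
    show "card ` (Pow U - {{}}) \<subseteq> {1..?n}"
    proof (rule image_subsetI)
      fix I assume I: "I \<in> Pow U - {{}}"
      then have "finite I" using assms(1) finite_subset by blast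
      then show "card I \<in> {1..?n}"
        using I card_mono[OF assms(1), of I] by (simp add: card_gt_0_iff Suc_le_eq)
    qed
  qed (use assms(1) in auto)
  also have "\<dots> = (\<Sum>k\<in>{1..?n}. 1 / real ?n)"
  proof (intro sum.cong refl)
    fix k assume k: "k \<in> {1..?n}"
    have "{I\<in>Pow U - {{}}. card I = k} = {I. I \<subseteq> U \<and> card I = k}" using k by auto
    then have "card {I\<in>Pow U - {{}}. card I = k} = ?n choose k"
      using n_subsets[OF assms(1), of k] by simp
    moreover have "?n choose k > 0" using k by simp
    ultimately show "(\<Sum>I\<in>{I\<in>Pow U - {{}}. card I = k}. 1 / (real ?n * real (?n choose card I))) = 1 / real ?n"
      by simp
  qed
  also have "\<dots> = 1" using n by simp
  finally show ?thesis .
qed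

text \<open>
  The row (or column) factor in the bound for the probability that a near competitor wins. The power
  \<open>-21/20\<close> slightly exceeds in size the power \<open>-1\<close> that would cancel the number of competitors.
\<close>

definition symm_diff_weight :: "nat set \<Rightarrow> nat set \<Rightarrow> nat \<Rightarrow> real" where
  "symm_diff_weight S I n = (real (card S) powr (-21/20)) ^ card (S - I)
     * ((real n - real (card S)) powr (-21/20)) ^ card (I - S)"

text \<open>
  By \<open>1 + x \<le> exp x\<close>, each of the two factors in the closed form is at most
  \<open>exp (z * z powr (-21/20))\<close>, where \<open>z\<close> is the size of \<open>S\<close> or of its complement.
\<close>

lemma sum_symm_diff_weight_le:
  assumes "S \<subseteq> {1..n}" "2 \<le> card S" "4 * card S \<le> n"
  shows "(\<Sum>I\<in>Pow {1..n}. symm_diff_weight S I n)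
    \<le> exp (real (card S) powr (-1/20) + (real n - real (card S)) powr (-1/20))"
proof -
  have pow_le: "(1 + z powr (-21/20)) ^ k \<le> exp (z powr (-1/20))" if "z = real k" "0 < z" for z k
  proof -
    have "(1 + z powr (-21/20)) ^ k \<le> exp (z powr (-21/20)) ^ k"
      by (intro power_mono exp_ge_add_one_self) auto
    also have "\<dots> = exp (z * z powr (-21/20))" by (simp add: exp_of_nat_mult that(1))
    also have "z * z powr (-21/20) = z powr 1 * z powr (-21/20)" using that(2) by simp
    also have "\<dots> = z powr (-1/20)" unfolding powr_add[symmetric] by simp
    finally show ?thesis .
  qed
  have "card ({1..n} - S) = n - card S" using assms(1) by (subst card_Diff_subset) (auto intro: finite_subset)
  then have rest: "real n - real (card S) = real (card ({1..n} - S))" using assms(3) by simp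
  have "(\<Sum>I\<in>Pow {1..n}. symm_diff_weight S I n)
      = (1 + real (card S) powr (-21/20)) ^ card S * (1 + (real n - real (card S)) powr (-21/20)) ^ card ({1..n} - S)"
    unfolding symm_diff_weight_def using assms(1) by (intro sum_subsets_symm_diff_weight) auto
  also have "\<dots> \<le> exp (real (card S) powr (-1/20)) * exp ((real n - real (card S)) powr (-1/20))"
    using assms rest by (intro mult_mono pow_le) auto
  finally show ?thesis by (simp add: exp_add)
qed

section \<open>Binomial coefficients and the penalty\<close>

text \<open>
  For \<open>k \<ge> a\<close>, the step from \<open>k\<close> to \<open>k + 1\<close> multiplies the binomial coefficient by
  \<open>(M - k)/(k + 1) \<le> M/a\<close>.
\<close>

lemma binomial_ratio_le:
  assumes "0 < a" "a \<le> m" "m \<le> M"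
  shows "real (M choose m) \<le> real (M choose a) * (real M / real a) ^ (m - a)"
  using assms(2,3)
proof (induction m rule: dec_induct)
  case (step k)
  have "real (Suc k) * real (M choose Suc k) = real (M - k) * real (M choose k)"
    using binomial_absorb_comp[of M k] Suc_times_binomial_eq
    by (metis binomial_absorption of_nat_mult)
  then have "real (M choose Suc k) = real (M choose k) * (real (M - k) / real (Suc k))"
    by (simp add: field_simps del: of_nat_Suc)
  also have "\<dots> \<le> real (M choose a) * (real M / real a) ^ (k - a) * (real M / real a)"
    using step assms(1) by (intro mult_mono frac_le) auto
  finally show ?case using step by (simp add: Suc_diff_le mult_ac)
qed simp

text \<open>
  This controls one half (rows or columns) of
  \<open>\<lambda> - \<lambda>' = (\<lambda>\<^sup>2 - \<lambda>'\<^sup>2) / (\<lambda> + \<lambda>')\<close>. If no index is lost on balance, the binomial coefficient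
  can only have grown. Otherwise put \<open>h = ln (M/a)\<close>: the numerator is at most \<open>2 (m - a) h\<close>,
  while both \<open>\<lambda>\<close> and \<open>\<lambda>'\<close> are at least \<open>\<surd>(2 a h)\<close> because \<open>(M/a)\<^sup>a\<close> bounds the smaller of the two
  binomial coefficients from below. Since \<open>a \<ge> (16/25) m\<close>, the quotient is at most \<open>(m - a) \<surd>(h/m) / \<surd>1.28\<close>, and
  \<open>h\<close> is below the logarithm in the detection threshold.
\<close>

lemma entropy_drop_le:
  fixes M m a :: nat and l l' :: real
  assumes m: "2 \<le> m" "4 * m \<le> M" and a: "16 * m \<le> 25 * a" "16 * a \<le> 25 * m"
    and l: "sqrt (2 * ln (M choose m)) \<le> l" "sqrt (2 * ln (M choose a)) \<le> l'" "0 < l + l'"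
  shows "2 * (ln (M choose m) - ln (M choose a)) / (l + l')
    \<le> 9/10 * max 0 (real m - real a) * sqrt ((ln (real M - real m) + ln (real m)) / real m)"
proof (cases "m \<le> a")
  case True
  then have "M choose m \<le> M choose a" using m a by (intro binomial_mono) auto
  moreover have "0 < M choose m" using m by simp
  ultimately have "ln (real (M choose m)) \<le> ln (real (M choose a))"
    by (subst ln_le_cancel_iff) (auto simp del: zero_less_binomial_iff)
  then show ?thesis using True l(3) by (simp add: divide_le_0_iff max_def)
next
  case False
  then have am: "a < m" by simp
  have a0: "0 < a" using m a by simp
  define h where "h = ln (real M / real a)"
  define L where "L = ln (real M - real m) + ln (real m)"
  have h0: "0 < h" unfolding h_def using am a0 m by simp
  have hL: "h \<le> L"
  proof -
    have "16 * real m \<le> 25 * real a" using a(1) by linarith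
    then have "2 \<le> real a * real m" using mult_mono[of 1 "real a" 2 "real m"] m a0 by simp
    then have "2 * (real M - real m) \<le> real a * real m * (real M - real m)"
      using m by (intro mult_right_mono) auto
    then have "real M \<le> real a * ((real M - real m) * real m)" using m by (simp add: mult_ac)
    then have "real M / real a \<le> (real M - real m) * real m" using a0 by (simp add: field_simps)
    then have "h \<le> ln ((real M - real m) * real m)"
      unfolding h_def using a0 m by (subst ln_le_cancel_iff) auto
    then show ?thesis using m by (simp add: L_def ln_mult)
  qed
  have entropy: "real a * h \<le> ln (M choose a)"
  proof -
    have "(real M / real a) ^ a \<le> real (M choose a)"
      using am m by (intro binomial_ge_n_over_k_pow_k) simp
    then have "ln ((real M / real a) ^ a) \<le> ln (M choose a)"
      using a0 am m by (subst ln_le_cancel_iff) auto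
    then show ?thesis using a0 m by (simp add: h_def ln_realpow)
  qed
  have "M choose a \<le> M choose m" using am m by (intro binomial_mono) auto
  moreover have c0: "0 < M choose a" "0 < M choose m" using am m by auto
  ultimately have entropy_mono: "ln (M choose a) \<le> ln (M choose m)"
    by (subst ln_le_cancel_iff) (auto simp del: zero_less_binomial_iff)
  have "sqrt (2 * (real a * h)) \<le> l" "sqrt (2 * (real a * h)) \<le> l'"
    using l entropy entropy_mono by (auto intro: order_trans[rotated])
  then have denom: "2 * sqrt (2 * (real a * h)) \<le> l + l'" by simp
  have "real (M choose m) \<le> real (M choose a) * (real M / real a) ^ (m - a)"
    using a0 am m by (intro binomial_ratio_le) auto
  then have "ln (M choose m) \<le> ln (real (M choose a) * (real M / real a) ^ (m - a))"
    using c0 a0 m by (subst ln_le_cancel_iff) auto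
  also have "\<dots> = ln (M choose a) + (real m - real a) * h"
    using c0 a0 m am by (simp add: ln_mult ln_realpow h_def of_nat_diff)
  finally have num: "ln (M choose m) - ln (M choose a) \<le> (real m - real a) * h" by simp
  define s where "s = sqrt (L / real m)"
  have "2 * ((real m - real a) * h) \<le> 9/10 * (real m - real a) * s * (2 * sqrt (2 * (real a * h)))"
  proof -
    have "sqrt (h * h) \<le> sqrt (81/50 * (L * (real a * h) / real m))"
    proof (rule real_sqrt_le_mono)
      have "real m * (h * h) \<le> 25/16 * (real a * (h * h))" using a h0 by simp
      also have "\<dots> \<le> 25/16 * (real a * (h * L))"
        using hL h0 a0 by simp
      also have "\<dots> \<le> 81/50 * (L * (real a * h))"
        using hL h0 a0 by simp
      finally show "h * h \<le> 81/50 * (L * (real a * h) / real m)" using m by (simp add: field_simps)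
    qed
    also have "\<dots> = sqrt ((9/10)\<^sup>2 * ((L / real m) * (2 * (real a * h))))"
      by (simp add: power2_eq_square)
    also have "\<dots> = 9/10 * s * sqrt (2 * (real a * h))"
      by (simp only: real_sqrt_mult s_def) simp
    finally have "h \<le> 9/10 * s * sqrt (2 * (real a * h))" using h0 by simp
    then have "2 * (real m - real a) * h \<le> 2 * (real m - real a) * (9/10 * s * sqrt (2 * (real a * h)))"
      using am by (intro mult_left_mono) auto
    then show ?thesis by (simp only: mult_ac)
  qed
  also have "\<dots> \<le> 9/10 * (real m - real a) * s * (l + l')"
  proof -
    have "0 \<le> s" using h0 hL by (simp add: s_def)
    then show ?thesis using denom am by (intro mult_left_mono) auto
  qed
  finally have "2 * (ln (M choose m) - ln (M choose a)) \<le> 9/10 * (real m - real a) * s * (l + l')"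
    using num by simp
  then show ?thesis using l(3) am by (simp add: s_def L_def divide_le_eq)
qed

text \<open>
  The penalty is calibrated so that the Gaussian tail bound \<open>exp (- \<lambda>\<^sup>2 / 2)\<close> at its level is the product
  of two weights as in \<open>sum_inverse_binomial_subsets\<close>, one for the rows and one for the columns.
\<close>

lemma scan_penalty_bounds:
  assumes "1 \<le> M" "1 \<le> N" "a \<le> M" "b \<le> N"
  shows "exp (- (scan_penalty M N a b)\<^sup>2 / 2) = 1 / (real M * real (M choose a)) * (1 / (real N * real (N choose b)))"
    and "sqrt (2 * ln (real M * real N)) \<le> scan_penalty M N a b"
    and "sqrt (2 * ln (real (M choose a))) \<le> scan_penalty M N a b"
    and "sqrt (2 * ln (real (N choose b))) \<le> scan_penalty M N a b"
    and "(scan_penalty M N a b)\<^sup>2 = 2 * (ln (real M * real N) + ln (real (M choose a)) + ln (real (N choose b)))"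
proof -
  have ge1: "1 \<le> real (M choose a)" "1 \<le> real (N choose b)" "1 \<le> real M" "1 \<le> real N"
    using assms by (simp_all add: Suc_le_eq)
  then have nonneg: "0 \<le> ln (real (M choose a))" "0 \<le> ln (real (N choose b))" "0 \<le> ln (real M)" "0 \<le> ln (real N)"
    by simp_all
  have expand: "ln (real M * real N * real (M choose a) * real (N choose b))
      = ln (real M) + ln (real N) + ln (real (M choose a)) + ln (real (N choose b))"
  proof -
    have "ln (v * w * x * y) = ln v + ln w + ln x + ln y"
      if "1 \<le> v" "1 \<le> w" "1 \<le> x" "1 \<le> y" for v w x y :: real
      using that by (simp add: ln_mult)
    then show ?thesis using ge1 by blast
  qed
  have MN: "ln (real M * real N) = ln (real M) + ln (real N)" using ge1 by (simp add: ln_mult)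
  have sq: "(scan_penalty M N a b)\<^sup>2 = 2 * ln (real M * real N * real (M choose a) * real (N choose b))"
    using nonneg unfolding scan_penalty_def expand by simp
  show "exp (- (scan_penalty M N a b)\<^sup>2 / 2) = 1 / (real M * real (M choose a)) * (1 / (real N * real (N choose b)))"
  proof -
    have inv: "exp (- (2 * ln Q) / 2) = 1 / Q" if "0 < Q" for Q :: real
      using that by (simp add: exp_minus inverse_eq_divide)
    show ?thesis unfolding sq by (subst inv) (use assms in \<open>auto intro!: mult_pos_pos simp: mult_ac\<close>)
  qed
  show "(scan_penalty M N a b)\<^sup>2 = 2 * (ln (real M * real N) + ln (real (M choose a)) + ln (real (N choose b)))"
    unfolding sq expand MN by simp
  show "sqrt (2 * ln (real M * real N)) \<le> scan_penalty M N a b"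
    "sqrt (2 * ln (real (M choose a))) \<le> scan_penalty M N a b"
    "sqrt (2 * ln (real (N choose b))) \<le> scan_penalty M N a b"
    unfolding scan_penalty_def expand MN using nonneg by (auto intro!: real_sqrt_le_mono)
qed

lemma scan_penalty_nonneg:
  assumes "1 \<le> M" "1 \<le> N" "a \<le> M" "b \<le> N"
  shows "0 \<le> scan_penalty M N a b"
proof -
  have "0 \<le> sqrt (2 * ln (real M * real N))"
    using assms mult_mono[of 1 "real M" 1 "real N"] by simp
  then show ?thesis using scan_penalty_bounds(2)[OF assms] by linarith
qed

section \<open>Overlap of two blocks\<close>

text \<open>
  The coefficients of the normalized sum over a block, as a unit vector. Signal and noise of a block are
  then inner products, and the overlap of two blocks is the inner product of their unit vectors.
\<close>

definition block_weight :: "nat set \<Rightarrow> nat set \<Rightarrow> nat \<times> nat \<Rightarrow> real" where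
  "block_weight I J ij = indicator (I \<times> J) ij / sqrt (real (card I) * real (card J))"

definition overlap :: "nat set \<Rightarrow> nat set \<Rightarrow> nat set \<Rightarrow> nat set \<Rightarrow> real" where
  "overlap A B I J = real (card (A \<inter> I) * card (B \<inter> J))
     / (sqrt (real (card A) * real (card B)) * sqrt (real (card I) * real (card J)))"

lemma sum_block_weight:
  assumes "finite K" "I \<times> J \<subseteq> K"
  shows "(\<Sum>ij\<in>K. block_weight I J ij * f ij) = (\<Sum>ij\<in>I \<times> J. f ij) / sqrt (real (card I) * real (card J))"
proof -
  have "(\<Sum>ij\<in>K. block_weight I J ij * f ij) = (\<Sum>ij\<in>I \<times> J. f ij / sqrt (real (card I) * real (card J)))"
    using assms by (intro sum.mono_neutral_cong_right) (auto simp: block_weight_def)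
  then show ?thesis by (simp add: sum_divide_distrib)
qed

lemma sum_block_weight_block_weight:
  assumes "finite K" "I \<times> J \<subseteq> K"
  shows "(\<Sum>ij\<in>K. block_weight I J ij * block_weight A B ij) = overlap A B I J"
proof (cases "finite (I \<times> J)")
  case True
  have "(\<Sum>ij\<in>I \<times> J. indicator (A \<times> B) ij) = real (card ((I \<times> J) \<inter> (A \<times> B)))"
    using True by (simp add: indicator_def sum.If_cases Int_def)
  also have "(I \<times> J) \<inter> (A \<times> B) = (A \<inter> I) \<times> (B \<inter> J)" by auto
  finally have "(\<Sum>ij\<in>I \<times> J. block_weight A B ij)
      = real (card (A \<inter> I) * card (B \<inter> J)) / sqrt (real (card A) * real (card B))"
    by (simp add: block_weight_def sum_divide_distrib[symmetric] card_cartesian_product)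
  then show ?thesis by (simp add: sum_block_weight[OF assms] overlap_def)
next
  case False
  then show ?thesis using finite_subset[OF assms(2,1)] by simp
qed

lemma overlap_self: "finite I \<Longrightarrow> finite J \<Longrightarrow> I \<noteq> {} \<Longrightarrow> J \<noteq> {} \<Longrightarrow> overlap I J I J = 1"
  by (simp add: overlap_def card_gt_0_iff)

lemma overlap_le_1:
  assumes "finite A" "finite B" "finite I" "finite J"
  shows "overlap A B I J \<le> 1"
proof -
  let ?s = "real (card (A \<inter> I))" and ?t = "real (card (B \<inter> J))"
  let ?den = "sqrt (real (card A) * real (card B)) * sqrt (real (card I) * real (card J))"
  have "?s \<le> card A" "?s \<le> card I" "?t \<le> card B" "?t \<le> card J"
    using assms by (auto intro!: card_mono)
  then have "(?s * ?t) * (?s * ?t) \<le> (real (card A) * real (card B)) * (real (card I) * real (card J))"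
    using mult_mono[of ?s "card A" ?s "card I"] mult_mono[of ?t "card B" ?t "card J"]
      mult_mono[of "?s * ?s" "card A * card I" "?t * ?t" "card B * card J"] by (simp add: mult_ac)
  then have "sqrt ((?s * ?t) * (?s * ?t)) \<le> ?den"
    by (subst real_sqrt_mult[symmetric]) (rule real_sqrt_le_mono)
  then have "?s * ?t \<le> ?den" by simp
  then show ?thesis by (auto simp: overlap_def divide_le_eq_1)
qed

text \<open>
  The squared overlap is the product of the four ratios obtained by dividing the row and column
  intersection sizes by the sizes of the four index sets. All of them are at most \<open>1\<close>, so each of them is
  at least \<open>16/25\<close> if the overlap is at least \<open>4/5\<close>.
\<close>

lemma large_overlapD:
  assumes fin: "finite A" "finite B" "finite I" "finite J" and overlap: "4/5 \<le> overlap A B I J"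
  shows "0 < card (A \<inter> I)" "16 * card A \<le> 25 * card I" "16 * card I \<le> 25 * card A"
proof -
  define s t where "s = card (A \<inter> I)" and "t = card (B \<inter> J)"
  let ?m = "real (card A)" and ?a = "real (card I)" and ?n = "real (card B)" and ?b = "real (card J)"
  have s: "real s \<le> ?m" "real s \<le> ?a" and t: "real t \<le> ?n" "real t \<le> ?b"
    using fin by (auto simp: s_def t_def intro!: card_mono)
  have nz: "overlap A B I J \<noteq> 0" using overlap by auto
  then have st: "0 < s" "0 < t" by (auto simp: overlap_def s_def t_def intro!: Nat.gr0I)
  then show "0 < card (A \<inter> I)" by (simp add: s_def)
  have "4/5 * (sqrt (?m * ?n) * sqrt (?a * ?b)) \<le> real s * real t"
    using overlap s t st by (simp add: overlap_def s_def t_def field_simps)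
  then have "(4/5 * (sqrt (?m * ?n) * sqrt (?a * ?b)))\<^sup>2 \<le> (real s * real t)\<^sup>2"
    by (intro power_mono) auto
  then have "16/25 * ((?m * ?a) * (?n * ?b)) \<le> (real s)\<^sup>2 * (real t)\<^sup>2"
    by (simp add: power_mult_distrib power_divide mult_ac)
  also have "\<dots> \<le> (real s)\<^sup>2 * (?n * ?b)"
    using mult_mono[of "real t" ?n "real t" ?b] t by (intro mult_left_mono) (auto simp: power2_eq_square)
  finally have "16/25 * (?m * ?a) * (?n * ?b) \<le> (real s)\<^sup>2 * (?n * ?b)" by (simp only: mult_ac)
  moreover have "0 < ?n * ?b" using st t by (intro mult_pos_pos) auto
  ultimately have ma: "16/25 * (?m * ?a) \<le> real s * real s"
    unfolding power2_eq_square by (rule mult_right_le_imp_le)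
  have pos: "0 < ?m" "0 < ?a" using st s by linarith+
  have "real s * real s \<le> ?m * ?m" "real s * real s \<le> ?a * ?a" using s by (auto intro!: mult_mono)
  with ma have "?m * (16/25 * ?a) \<le> ?m * ?m" "?a * (16/25 * ?m) \<le> ?a * ?a"
    by (auto simp: mult_ac)
  then have "16/25 * ?a \<le> ?m" "16/25 * ?m \<le> ?a" using pos by (metis mult_le_cancel_left_pos)+
  then show "16 * card A \<le> 25 * card I" "16 * card I \<le> 25 * card A" by linarith+
qed

lemma overlap_swap: "overlap A B I J = overlap B A J I"
  by (simp add: overlap_def mult_ac)

text \<open>
  Here \<open>s\<close>, \<open>t\<close> are the sizes of the intersections, \<open>p\<close>, \<open>p'\<close> the numbers of missed indices and
  \<open>q\<close>, \<open>q'\<close> those of added ones. The reciprocal of \<open>\<rho>\<^sup>2\<close> is the product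
  \<open>(1 + p/s) (1 + q/s) (1 + p'/t) (1 + q'/t)\<close>, which is at least \<open>1 + T\<close> for
  the sum \<open>T\<close> on the left. So \<open>1 - \<rho> \<ge> T \<rho>\<^sup>2 / (1 + \<rho>)\<close>, and \<open>\<rho>\<^sup>2 / (1 + \<rho>)\<close> increases in \<open>\<rho>\<close>, with value
  \<open>16/45\<close> at \<open>4/5\<close>.
\<close>

lemma deficit_lower_bound:
  fixes s t p q p' q' :: nat and \<rho> :: real
  assumes rho: "\<rho> * (sqrt ((s+p)*(s+q)) * sqrt ((t+p')*(t+q'))) = s * t" "4/5 \<le> \<rho>" "\<rho> \<le> 1"
    and pos: "0 < s" "0 < t"
  shows "16/45 * ((p+q) / (s+p) + (p'+q') / (t+p')) \<le> 1 - \<rho>"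
proof -
  define T where "T = (p+q) / (s+p) + (p'+q') / (t+p')"
  have T: "T \<le> (real p+q)/s + (real p'+q')/t"
    unfolding T_def using pos by (intro add_mono) (auto intro!: frac_le)
  have "\<rho>\<^sup>2 * ((real s+p)*(real s+q) * ((real t+p')*(real t+q'))) = (real s * real t)\<^sup>2"
  proof -
    have "real s * real t = \<rho> * (sqrt ((s+p)*(s+q)) * sqrt ((t+p')*(t+q')))" using rho(1) by simp
    then show ?thesis by (simp only: power_mult_distrib) simp
  qed
  moreover have "(real s * real t)\<^sup>2 * (1 + ((real p+q)/s + (real p'+q')/t))
      \<le> (real s+p)*(real s+q) * ((real t+p')*(real t+q'))"
  proof -
    have "(real s * real t)\<^sup>2 * (1 + ((real p+q)/s + (real p'+q')/t))
       = (real s * real t)\<^sup>2 + s * real t ^ 2 * (p+q) + real s ^ 2 * t * (p'+q')"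
      using pos by (simp add: field_simps power2_eq_square)
    also have "\<dots> \<le> (real s * s + s * (p+q)) * (real t * t + t * (p'+q'))"
      by (simp add: field_simps power2_eq_square)
    also have "\<dots> \<le> ((real s+p)*(real s+q)) * ((real t+p')*(real t+q'))"
      by (intro mult_mono) (auto simp: algebra_simps)
    finally show ?thesis .
  qed
  ultimately have "\<rho>\<^sup>2 * ((real s * real t)\<^sup>2 * (1 + ((real p+q)/s + (real p'+q')/t))) \<le> (real s * real t)\<^sup>2"
    using mult_left_mono[OF _ zero_le_power2[of \<rho>]] by fastforce
  then have "(real s * real t)\<^sup>2 * (\<rho>\<^sup>2 * (1 + ((real p+q)/s + (real p'+q')/t))) \<le> (real s * real t)\<^sup>2 * 1"
    by (simp only: mult.left_commute mult_1_right)
  then have "\<rho>\<^sup>2 * (1 + ((real p+q)/s + (real p'+q')/t)) \<le> 1"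
    using pos by (subst (asm) mult_le_cancel_left_pos) auto
  moreover have "\<rho>\<^sup>2 * (1 + T) \<le> \<rho>\<^sup>2 * (1 + ((real p+q)/s + (real p'+q')/t))"
    using T by (intro mult_left_mono) auto
  ultimately have "\<rho>\<^sup>2 * (1 + T) \<le> 1" by (rule order_trans[rotated])
  then have *: "\<rho>\<^sup>2 * T \<le> (1 - \<rho>) * (1 + \<rho>)"
    by (simp add: algebra_simps power2_eq_square)
  have T0: "0 \<le> T" by (simp add: T_def)
  have "0 \<le> (\<rho> - 4/5) * (\<rho> + 4/9)" using rho(2) by (intro mult_nonneg_nonneg) auto
  then have "16/45 * (1 + \<rho>) \<le> \<rho>\<^sup>2"
    by (simp add: power2_eq_square algebra_simps)
  then have "16/45 * T * (1 + \<rho>) \<le> (1 - \<rho>) * (1 + \<rho>)"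
  proof -
    have "16/45 * T * (1 + \<rho>) = 16/45 * (1 + \<rho>) * T" by simp
    also have "\<dots> \<le> \<rho>\<^sup>2 * T" using T0 \<open>16/45 * (1 + \<rho>) \<le> \<rho>\<^sup>2\<close> by (intro mult_right_mono)
    finally show ?thesis using * by linarith
  qed
  then show ?thesis using rho(2) by (simp add: T_def mult_le_cancel_right)
qed

lemma one_minus_overlap_ge:
  assumes fin: "finite A" "finite B" "finite I" "finite J" and overlap: "4/5 \<le> overlap A B I J"
  shows "16/45 * ((real (card (A - I)) + real (card (I - A))) / card A
      + (real (card (B - J)) + real (card (J - B))) / card B) \<le> 1 - overlap A B I J"
proof -
  have cards: "card A = card (A \<inter> I) + card (A - I)" "card I = card (A \<inter> I) + card (I - A)"
    "card B = card (B \<inter> J) + card (B - J)" "card J = card (B \<inter> J) + card (J - B)"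
    using card_Int_Diff[of A I] card_Int_Diff[of I A] card_Int_Diff[of B J] card_Int_Diff[of J B] fin
    by (simp_all add: Int_commute)
  have pos: "0 < card (A \<inter> I)" "0 < card (B \<inter> J)"
    using large_overlapD(1)[OF fin overlap] large_overlapD(1)[of B A J I] fin overlap
    by (simp_all add: overlap_swap)
  have "overlap A B I J * (sqrt (real (card A) * real (card B)) * sqrt (real (card I) * real (card J)))
      = real (card (A \<inter> I) * card (B \<inter> J))"
    using pos cards by (simp add: overlap_def)
  moreover have "sqrt (real (card A) * real (card B)) * sqrt (real (card I) * real (card J))
      = sqrt (real (card A) * real (card I)) * sqrt (real (card B) * real (card J))"
    by (simp add: real_sqrt_mult mult_ac)
  ultimately have eq: "overlap A B I J * (sqrt (real (card A * card I)) * sqrt (real (card B * card J)))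
      = real (card (A \<inter> I) * card (B \<inter> J))" by simp
  have "16/45 * (real (card (A - I) + card (I - A)) / real (card (A \<inter> I) + card (A - I))
      + real (card (B - J) + card (J - B)) / real (card (B \<inter> J) + card (B - J))) \<le> 1 - overlap A B I J"
    using eq unfolding cards
    by (intro deficit_lower_bound overlap overlap_le_1 fin pos) (simp_all only: cards[symmetric])
  then show ?thesis by (simp only: cards[symmetric]) simp
qed

section \<open>Gaussian tails and measurability of the maximizer\<close>

text \<open>
  Completing the square turns the tilted density into a shifted normal density.
\<close>

lemma nn_integral_exp_std_normal:
  "(\<integral>\<^sup>+x. ennreal (std_normal_density x) * ennreal (exp (c * x)) \<partial>lborel) = ennreal (exp (c\<^sup>2 / 2))"
proof -
  have "std_normal_density x * exp (c * x) = exp (c\<^sup>2 / 2) * normal_density c 1 x" for x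
  proof -
    have "- x\<^sup>2 / 2 + c * x = c\<^sup>2 / 2 + - (x - c)\<^sup>2 / 2"
      by (simp add: power2_eq_square field_simps)
    then have "exp (- x\<^sup>2 / 2) * exp (c * x) = exp (c\<^sup>2 / 2) * exp (- (x - c)\<^sup>2 / 2)"
      by (simp only: exp_add[symmetric])
    then show ?thesis by (simp add: normal_density_def)
  qed
  then have "(\<integral>\<^sup>+x. ennreal (std_normal_density x) * ennreal (exp (c * x)) \<partial>lborel)
      = (\<integral>\<^sup>+x. ennreal (exp (c\<^sup>2 / 2)) * ennreal (normal_density c 1 x) \<partial>lborel)"
    by (simp add: ennreal_mult[symmetric])
  also have "\<dots> = ennreal (exp (c\<^sup>2 / 2)) * (\<integral>\<^sup>+x. ennreal (normal_density c 1 x) \<partial>lborel)"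
    by (rule nn_integral_cmult) simp
  also have "(\<integral>\<^sup>+x. ennreal (normal_density c 1 x) \<partial>lborel) = 1"
    by (subst nn_integral_eq_integral) auto
  finally show ?thesis by simp
qed

text \<open>
  The exponential Markov inequality with tilt \<open>1\<close>: a different tilt is obtained by scaling \<open>c\<close> and \<open>t\<close>.
\<close>

lemma (in prob_space) gaussian_linear_form_tail:
  fixes X :: "'i \<Rightarrow> 'a \<Rightarrow> real"
  assumes fin: "finite K" and indep: "indep_vars (\<lambda>_. borel) X K"
    and normal: "\<And>i. i \<in> K \<Longrightarrow> distributed M lborel (X i) std_normal_density"
  shows "prob {\<omega> \<in> space M. t \<le> (\<Sum>i\<in>K. c i * X i \<omega>)} \<le> exp ((\<Sum>i\<in>K. (c i)\<^sup>2) / 2 - t)"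
proof -
  have [measurable]: "X i \<in> borel_measurable M" if "i \<in> K" for i
    using distributed_measurable[OF normal[OF that]] by simp
  have "ennreal (prob {\<omega> \<in> space M. t \<le> (\<Sum>i\<in>K. c i * X i \<omega>)})
      \<le> ennreal (exp (- 1 * t)) * (\<integral>\<^sup>+\<omega>\<in>space M. exp (1 * (\<Sum>i\<in>K. c i * X i \<omega>)) \<partial>M)"
    unfolding emeasure_eq_measure[symmetric] by (intro Chernoff_ineq_nn_integral_ge) auto
  also have "(\<integral>\<^sup>+\<omega>\<in>space M. exp (1 * (\<Sum>i\<in>K. c i * X i \<omega>)) \<partial>M)
      = (\<integral>\<^sup>+\<omega>. (\<Prod>i\<in>K. ennreal (exp (c i * X i \<omega>))) \<partial>M)"
    by (intro nn_integral_cong) (simp_all add: exp_sum fin prod_ennreal)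
  also have "\<dots> = (\<Prod>i\<in>K. \<integral>\<^sup>+\<omega>. ennreal (exp (c i * X i \<omega>)) \<partial>M)"
    by (intro indep_vars_nn_integral fin indep_vars_compose2[OF indep]) auto
  also have "\<dots> = (\<Prod>i\<in>K. ennreal (exp ((c i)\<^sup>2 / 2)))"
  proof (rule prod.cong[OF refl])
    fix i assume "i \<in> K"
    from distributed_nn_integral[OF normal[OF this], of "\<lambda>x. ennreal (exp (c i * x))"]
    show "(\<integral>\<^sup>+\<omega>. ennreal (exp (c i * X i \<omega>)) \<partial>M) = ennreal (exp ((c i)\<^sup>2 / 2))"
      by (simp add: nn_integral_exp_std_normal)
  qed
  also have "\<dots> = ennreal (exp ((\<Sum>i\<in>K. (c i)\<^sup>2) / 2))"
    by (simp add: prod_ennreal exp_sum fin sum_divide_distrib)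
  also have "ennreal (exp (- 1 * t)) * \<dots> = ennreal (exp ((\<Sum>i\<in>K. (c i)\<^sup>2) / 2 - t))"
    by (simp add: ennreal_mult[symmetric] exp_add[symmetric])
  finally show ?thesis by simp
qed

text \<open>
  The selected maximizer is a function of the set of maximizers, which takes finitely many values;
  each of them is attained on an event described by finitely many inequalities.
\<close>

lemma measurable_arg_max_on:
  fixes f :: "'b \<Rightarrow> 'a \<Rightarrow> real"
  assumes "finite S" and f: "\<And>x. x \<in> S \<Longrightarrow> f x \<in> borel_measurable P"
  shows "{\<omega> \<in> space P. arg_max_on (\<lambda>x. f x \<omega>) S = v} \<in> sets P"
proof -
  define maximizers where "maximizers \<omega> = {x \<in> S. \<forall>y\<in>S. f y \<omega> \<le> f x \<omega>}" for \<omega>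
  have eq: "arg_max_on (\<lambda>x. f x \<omega>) S = (SOME x. x \<in> maximizers \<omega>)" for \<omega>
    by (simp add: arg_max_on_def arg_max_def is_arg_max_linorder maximizers_def Ball_def)
  have "{\<omega> \<in> space P. arg_max_on (\<lambda>x. f x \<omega>) S = v}
      = (\<Union>R\<in>{R \<in> Pow S. (SOME x. x \<in> R) = v}. {\<omega> \<in> space P. maximizers \<omega> = R})"
    by (auto simp: eq maximizers_def)
  also have "\<dots> \<in> sets P"
  proof (rule sets.finite_UN)
    fix R assume R: "R \<in> {R \<in> Pow S. (SOME x. x \<in> R) = v}"
    have "{\<omega> \<in> space P. maximizers \<omega> = R}
        = {\<omega> \<in> space P. \<forall>x\<in>S. (\<forall>y\<in>S. f y \<omega> \<le> f x \<omega>) \<longleftrightarrow> x \<in> R}"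
      using R by (auto simp: maximizers_def)
    also have "\<dots> \<in> sets P"
    proof (intro sets.sets_Collect_finite_All assms(1))
      fix x assume x: "x \<in> S"
      have max: "{\<omega> \<in> space P. \<forall>y\<in>S. f y \<omega> \<le> f x \<omega>} \<in> sets P"
        using f x by (intro sets.sets_Collect_finite_All assms(1) borel_measurable_le) auto
      show "{\<omega> \<in> space P. (\<forall>y\<in>S. f y \<omega> \<le> f x \<omega>) \<longleftrightarrow> x \<in> R} \<in> sets P"
        using max sets.sets_Collect_neg[OF max] by (cases "x \<in> R") simp_all
    qed
    finally show "{\<omega> \<in> space P. maximizers \<omega> = R} \<in> sets P" .
  qed (use assms(1) in auto)
  finally show ?thesis .
qed

section \<open>Recovery of a planted block for fixed dimensions\<close>

text \<open>
  Write \<open>x = ln m\<close>, \<open>y = ln (M - m)\<close> and \<open>L = x + y\<close>, so that \<open>G\<^sup>2 / m \<ge> 25 L\<close>. If \<open>p \<le> q\<close> there is no loss of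
  penalty, and the left-hand side is at most \<open>- (5/3) (p + q) L\<close>, which suffices. If \<open>p > q\<close>, the
  penalty reduces the constant to \<open>13/24\<close>, but then mostly the cheap missed indices have to be paid for:
  \<open>x \<le> y\<close> gives \<open>p x + q y \<le> (p + q) L / 2\<close>, and \<open>13/24 \<ge> 21/40\<close>. The
  factors \<open>G/4\<close> and \<open>3/16\<close> come from the tilt \<open>G/4\<close>, which is close to optimal for \<open>p > q\<close>.
\<close>

lemma one_sided_exponent_le:
  fixes p q m M :: nat and G :: real
  assumes m: "2 \<le> m" "4 * m \<le> M"
    and G: "5 * sqrt (real m * (ln (real M - real m) + ln (real m))) \<le> G"
  shows "G / 4 * (9/10 * max 0 (real p - real q) * sqrt ((ln (real M - real m) + ln (real m)) / real m))
     - 3/16 * G\<^sup>2 * (16/45 * ((real p + real q) / real m))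
     \<le> - (21/20) * (p * ln (real m) + q * ln (real M - real m))"
proof -
  define x where "x = ln (real m)"
  define y where "y = ln (real M - real m)"
  define d where "d = max 0 (real p - real q)"
  have x: "0 \<le> x" "x \<le> y" using m by (auto simp: x_def y_def)
  have G0: "0 \<le> G" by (rule order_trans[OF _ G]) (use m x in \<open>auto simp: x_def y_def\<close>)
  have sq: "sqrt ((y + x) / m) = sqrt (m * (y + x)) / m"
  proof -
    have "sqrt ((y + x) / m) = sqrt (m * (y + x) / (real m)\<^sup>2)"
      using m by (simp add: power2_eq_square)
    then show ?thesis by (simp add: real_sqrt_divide)
  qed
  have "sqrt ((y + x) / m) \<le> G / 5 / m"
    unfolding sq using G by (intro divide_right_mono) (auto simp: x_def y_def)
  then have "G / 4 * (9/10 * d * sqrt ((y + x) / m)) \<le> G / 4 * (9/10 * d * (G / 5 / m))"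
    using G0 by (intro mult_left_mono) (auto simp: d_def)
  also have "\<dots> = G\<^sup>2 / m * (9/200 * d)" by (simp add: power2_eq_square mult_ac)
  finally have "G / 4 * (9/10 * d * sqrt ((y + x) / m)) - 3/16 * G\<^sup>2 * (16/45 * ((real p + real q) / real m))
      \<le> G\<^sup>2 / m * (9/200 * d) - 3/16 * G\<^sup>2 * (16/45 * ((real p + real q) / real m))" by simp
  also have "\<dots> = G\<^sup>2 / m * (9/200 * d - (real p + real q) / 15)"
    using m by (simp add: field_simps)
  also have "\<dots> \<le> 25 * (y + x) * (9/200 * d - (real p + real q) / 15)"
  proof (rule mult_right_mono_neg)
    have "(5 * sqrt (m * (y + x)))\<^sup>2 \<le> G\<^sup>2"
      using G x by (intro power_mono) (auto simp: x_def y_def)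
    then show "25 * (y + x) \<le> G\<^sup>2 / m" using m x by (simp add: power_mult_distrib field_simps)
    show "9/200 * d - (real p + real q) / 15 \<le> 0" by (simp add: d_def max_def)
  qed
  also have "\<dots> \<le> - (21/20) * (p * x + q * y)"
  proof -
    define u v where "u = real p * x" and "v = real q * x"
    define w z where "w = real p * y" and "z = real q * y"
    have nonneg: "0 \<le> u" "0 \<le> v" "0 \<le> w" "0 \<le> z"
      using x by (auto simp: u_def v_def w_def z_def)
    have "21/20 * u + 21/20 * z \<le> - (25 * (y + x) * (9/200 * d - (real p + real q) / 15))"
    proof (cases "p > q")
      case True
      then have d: "d = real p - real q" by (simp add: d_def)
      have "(real p - real q) * (y - x) \<ge> 0" using True x by simp
      then have "0 \<le> w - u - z + v" by (simp add: u_def v_def w_def z_def algebra_simps)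
      then have "21/20 * u + 21/20 * z \<le> 13/24 * u + 13/24 * w + 67/24 * v + 67/24 * z"
        using nonneg by linarith
      also have "\<dots> = - (25 * (y + x) * (9/200 * d - (real p + real q) / 15))"
        unfolding d u_def v_def w_def z_def by (simp add: field_simps)
      finally show ?thesis .
    next
      case False
      then have d: "d = 0" by (simp add: d_def)
      have "21/20 * u + 21/20 * z \<le> 5/3 * u + 5/3 * v + 5/3 * w + 5/3 * z" using nonneg by linarith
      also have "\<dots> = - (25 * (y + x) * (9/200 * d - (real p + real q) / 15))"
        unfolding d u_def v_def w_def z_def by (simp add: field_simps)
      finally show ?thesis .
    qed
    moreover have "- (21/20) * (p * x + q * y) = - (21/20 * u + 21/20 * z)"
      by (simp add: u_def z_def algebra_simps)
    ultimately show ?thesis by linarith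
  qed
  finally show ?thesis by (simp add: x_def y_def d_def)
qed

text \<open>
  The model for one fixed tuple of dimensions, with planted block \<open>A \<times> B\<close>. The sizes are in the range in which
  binomial coefficients increase up to index \<open>25/16\<close> times the planted size.
\<close>

locale planted_submatrix = prob_space P for P :: "'a measure" +
  fixes M N :: nat and A B :: "nat set" and \<theta> :: real and e :: "nat \<times> nat \<Rightarrow> 'a \<Rightarrow> real"
  assumes indep_noise: "indep_vars (\<lambda>_. borel) e ({1..M} \<times> {1..N})"
    and std_normal_noise: "\<And>ij. ij \<in> {1..M} \<times> {1..N} \<Longrightarrow> distributed P lborel (e ij) std_normal_density"
    and A: "A \<subseteq> {1..M}" "2 \<le> card A" "4 * card A \<le> M"
    and B: "B \<subseteq> {1..N}" "2 \<le> card B" "4 * card B \<le> N"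
begin

definition strength :: real where
  "strength = \<theta> * sqrt (real (card A) * real (card B))"

definition noise :: "nat set \<Rightarrow> nat set \<Rightarrow> 'a \<Rightarrow> real" where
  "noise I J \<omega> = (\<Sum>ij\<in>{1..M} \<times> {1..N}. block_weight I J ij * e ij \<omega>)"

definition candidates :: "(nat set \<times> nat set) set" where
  "candidates = {(I, J). I \<noteq> {} \<and> I \<subseteq> {1..M} \<and> J \<noteq> {} \<and> J \<subseteq> {1..N}}"

lemma finite_candidates: "finite candidates"
  by (rule finite_subset[of _ "Pow {1..M} \<times> Pow {1..N}"]) (auto simp: candidates_def)

lemma candidatesD:
  assumes "(I, J) \<in> candidates"
  shows "I \<noteq> {}" "J \<noteq> {}" "I \<subseteq> {1..M}" "J \<subseteq> {1..N}" "finite I" "finite J"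
    "I \<times> J \<subseteq> {1..M} \<times> {1..N}" "card I \<le> M" "card J \<le> N"
  using assms card_mono[of "{1..M}" I] card_mono[of "{1..N}" J]
  by (auto simp: candidates_def finite_subset[of I "{1..M}"] finite_subset[of J "{1..N}"])

lemma planted_candidate: "(A, B) \<in> candidates"
  using A B by (auto simp: candidates_def)

lemma M_N_pos: "1 \<le> M" "1 \<le> N"
  using A(2,3) B(2,3) by linarith+

lemma measurable_noise [measurable]: "noise I J \<in> borel_measurable P"
proof -
  have "e ij \<in> borel_measurable P" if "ij \<in> {1..M} \<times> {1..N}" for ij
    using distributed_measurable[OF std_normal_noise[OF that]] by simp
  then show ?thesis unfolding noise_def[abs_def] by (intro borel_measurable_sum) auto
qed

lemma criterion_eq:
  assumes "(I, J) \<in> candidates"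
  shows "scan_criterion M N (planted_matrix \<theta> A B (\<lambda>ij. e ij \<omega>)) (I, J)
    = strength * overlap A B I J + noise I J \<omega> - scan_penalty M N (card I) (card J)"
proof -
  let ?K = "{1..M} \<times> {1..N}"
  have "indicator (A \<times> B) ij = sqrt (real (card A) * real (card B)) * block_weight A B ij" for ij
    using A B by (simp add: block_weight_def)
  then have "planted_matrix \<theta> A B (\<lambda>ij. e ij \<omega>) ij = strength * block_weight A B ij + e ij \<omega>" for ij
    by (simp add: planted_matrix_def strength_def)
  then have "(\<Sum>ij\<in>?K. block_weight I J ij * planted_matrix \<theta> A B (\<lambda>ij. e ij \<omega>) ij)
      = strength * (\<Sum>ij\<in>?K. block_weight I J ij * block_weight A B ij) + noise I J \<omega>"
    by (simp add: noise_def algebra_simps sum.distrib sum_distrib_left)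
  then show ?thesis
    using candidatesD[OF assms]
    by (simp add: scan_criterion_def sum_block_weight[symmetric, of ?K] sum_block_weight_block_weight)
qed

text \<open>
  The difference of two unit vectors with inner product \<open>\<rho>\<close> has squared length \<open>2 - 2 \<rho>\<close>.
\<close>

lemma noise_difference_tail:
  assumes "(I, J) \<in> candidates"
  shows "prob {\<omega> \<in> space P. t \<le> h * (noise I J \<omega> - noise A B \<omega>)} \<le> exp (h\<^sup>2 * (1 - overlap A B I J) - t)"
proof -
  let ?K = "{1..M} \<times> {1..N}"
  let ?c = "\<lambda>ij. h * (block_weight I J ij - block_weight A B ij)"
  note cand = candidatesD[OF assms] and plant = candidatesD[OF planted_candidate]
  have "(\<Sum>ij\<in>?K. (?c ij)\<^sup>2)
      = h\<^sup>2 * (\<Sum>ij\<in>?K. block_weight I J ij * block_weight I J ij + block_weight A B ij * block_weight A B ij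
          - 2 * (block_weight I J ij * block_weight A B ij))"
    unfolding sum_distrib_left by (intro sum.cong) (auto simp: power2_eq_square algebra_simps)
  also have "\<dots> = h\<^sup>2 * (2 - 2 * overlap A B I J)"
    using cand plant
    by (simp add: sum.distrib sum_subtractf sum_distrib_left[symmetric] sum_block_weight_block_weight overlap_self)
  finally have var: "(\<Sum>ij\<in>?K. (?c ij)\<^sup>2) / 2 = h\<^sup>2 * (1 - overlap A B I J)" by simp
  have "(\<Sum>ij\<in>?K. ?c ij * e ij \<omega>) = h * (noise I J \<omega> - noise A B \<omega>)" for \<omega>
    by (simp add: noise_def algebra_simps sum_subtractf sum_distrib_left)
  moreover have "finite ?K" by simp
  ultimately show ?thesis
    using gaussian_linear_form_tail[OF _ indep_noise std_normal_noise, of t ?c] by (simp only: var)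
qed

lemma noise_tail:
  assumes "(I, J) \<in> candidates"
  shows "prob {\<omega> \<in> space P. t \<le> h * noise I J \<omega>} \<le> exp (h\<^sup>2 / 2 - t)"
proof -
  let ?K = "{1..M} \<times> {1..N}"
  let ?c = "\<lambda>ij. h * block_weight I J ij"
  have "(\<Sum>ij\<in>?K. (?c ij)\<^sup>2) = h\<^sup>2 * (\<Sum>ij\<in>?K. block_weight I J ij * block_weight I J ij)"
    unfolding sum_distrib_left by (intro sum.cong) (auto simp: power2_eq_square algebra_simps)
  also have "\<dots> = h\<^sup>2"
    using candidatesD[OF assms] by (simp add: sum_block_weight_block_weight overlap_self)
  finally have var: "(\<Sum>ij\<in>?K. (?c ij)\<^sup>2) / 2 = h\<^sup>2 / 2" by simp
  have "(\<Sum>ij\<in>?K. ?c ij * e ij \<omega>) = h * noise I J \<omega>" for \<omega>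
    by (simp add: noise_def algebra_simps sum_distrib_left)
  moreover have "finite ?K" by simp
  ultimately show ?thesis
    using gaussian_linear_form_tail[OF _ indep_noise std_normal_noise, of t ?c] by (simp only: var)
qed

text \<open>
  The squares of the penalties, unlike the penalties themselves, are sums of a row part and a column part,
  so the difference is written as \<open>(\<lambda>\<^sup>2 - \<lambda>'\<^sup>2) / (\<lambda> + \<lambda>')\<close> and \<open>entropy_drop_le\<close> is applied to each part.
\<close>

lemma penalty_difference_le:
  assumes cand: "(I, J) \<in> candidates" and ov: "4/5 \<le> overlap A B I J"
  shows "scan_penalty M N (card A) (card B) - scan_penalty M N (card I) (card J)
    \<le> 9/10 * max 0 (real (card A) - real (card I))
          * sqrt ((ln (real M - real (card A)) + ln (real (card A))) / card A)
      + 9/10 * max 0 (real (card B) - real (card J))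
          * sqrt ((ln (real N - real (card B)) + ln (real (card B))) / card B)"
proof -
  let ?l = "scan_penalty M N (card A) (card B)" and ?l' = "scan_penalty M N (card I) (card J)"
  note c = candidatesD[OF cand] and p = candidatesD[OF planted_candidate]
  note pen = scan_penalty_bounds[OF M_N_pos p(8,9)] scan_penalty_bounds[OF M_N_pos c(8,9)]
  have sizes: "16 * card A \<le> 25 * card I" "16 * card I \<le> 25 * card A"
      "16 * card B \<le> 25 * card J" "16 * card J \<le> 25 * card B"
    using large_overlapD(2,3)[OF p(5,6) c(5,6) ov] large_overlapD(2,3)[OF p(6,5) c(6,5)] ov
    by (auto simp: overlap_swap[of A B I J])
  have "0 < ln (real M * real N)"
  proof -
    have "8 * 8 \<le> real M * real N" using A(2,3) B(2,3) by (intro mult_mono) auto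
    then show ?thesis by (intro ln_gt_zero) linarith
  qed
  then have "0 < sqrt (2 * ln (real M * real N))" by simp
  then have pos: "0 < ?l + ?l'" using pen(2) pen(7) by linarith
  have "(?l - ?l') * (?l + ?l') = ?l\<^sup>2 - ?l'\<^sup>2" by (simp add: power2_eq_square algebra_simps)
  then have "?l - ?l' = (?l\<^sup>2 - ?l'\<^sup>2) / (?l + ?l')" using pos by (simp add: field_simps)
  also have "\<dots> = 2 * (ln (M choose card A) - ln (M choose card I)) / (?l + ?l')
      + 2 * (ln (N choose card B) - ln (N choose card J)) / (?l + ?l')"
    unfolding pen(5) pen(10) by (simp add: add_divide_distrib[symmetric] algebra_simps)
  also have "\<dots> \<le> 9/10 * max 0 (real (card A) - real (card I))
          * sqrt ((ln (real M - real (card A)) + ln (real (card A))) / card A)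
      + 9/10 * max 0 (real (card B) - real (card J))
          * sqrt ((ln (real N - real (card B)) + ln (real (card B))) / card B)"
    by (intro add_mono entropy_drop_le A(2,3) B(2,3) sizes pen pos)
  finally show ?thesis .
qed



text \<open>
  The event is that the competitor beats the planted block. The exponential Markov inequality with tilt
  \<open>G/4\<close> bounds it by an exponential whose exponent splits into a row part and a column part.
\<close>

lemma near_competitor_tail:
  assumes strong: "5 * sqrt (real (card A) * (ln (real M - real (card A)) + ln (real (card A)))) \<le> strength"
      "5 * sqrt (real (card B) * (ln (real N - real (card B)) + ln (real (card B)))) \<le> strength"
    and cand: "(I, J) \<in> candidates" and ov: "4/5 \<le> overlap A B I J"
  shows "prob {\<omega> \<in> space P. strength * (1 - overlap A B I J)
        \<le> noise I J \<omega> - noise A B \<omega> + (scan_penalty M N (card A) (card B) - scan_penalty M N (card I) (card J))}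
    \<le> symm_diff_weight A I M * symm_diff_weight B J N"
proof -
  define G where "G = strength"
  define D where "D = 1 - overlap A B I J"
  define \<Delta> where "\<Delta> = scan_penalty M N (card A) (card B) - scan_penalty M N (card I) (card J)"
  \<comment> \<open>\<open>dr\<close>, \<open>dc\<close> bound the row and column parts of the penalty loss, \<open>Tr\<close>, \<open>Tc\<close> those of \<open>1 - \<rho>\<close>\<close>
  define dr where "dr = 9/10 * max 0 (real (card (A - I)) - real (card (I - A)))
    * sqrt ((ln (real M - real (card A)) + ln (real (card A))) / card A)"
  define dc where "dc = 9/10 * max 0 (real (card (B - J)) - real (card (J - B)))
    * sqrt ((ln (real N - real (card B)) + ln (real (card B))) / card B)"
  define Tr where "Tr = 16/45 * ((real (card (A - I)) + real (card (I - A))) / card A)"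
  define Tc where "Tc = 16/45 * ((real (card (B - J)) + real (card (J - B))) / card B)"
  note c = candidatesD[OF cand] and p = candidatesD[OF planted_candidate]
  have G0: "0 \<le> G"
    unfolding G_def by (rule order_trans[OF _ strong(1)]) (use A in auto)
  have exponent: "3/16 * G\<^sup>2 * Tr - G / 4 * dr \<ge> 21/20 * (card (A - I) * ln (real (card A)) + card (I - A) * ln (real M - real (card A)))"
    "3/16 * G\<^sup>2 * Tc - G / 4 * dc \<ge> 21/20 * (card (B - J) * ln (real (card B)) + card (J - B) * ln (real N - real (card B)))"
  proof -
    have flip: "21/20 * z \<le> y - x" if "x - y \<le> - (21/20) * z" for x y z :: real using that by simp
    show "3/16 * G\<^sup>2 * Tr - G / 4 * dr \<ge> 21/20 * (card (A - I) * ln (real (card A)) + card (I - A) * ln (real M - real (card A)))"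
      unfolding G_def Tr_def dr_def by (rule flip[OF one_sided_exponent_le[OF A(2,3) strong(1)]])
    show "3/16 * G\<^sup>2 * Tc - G / 4 * dc \<ge> 21/20 * (card (B - J) * ln (real (card B)) + card (J - B) * ln (real N - real (card B)))"
      unfolding G_def Tc_def dc_def by (rule flip[OF one_sided_exponent_le[OF B(2,3) strong(2)]])
  qed
  have card_diff: "real (card X) - real (card Y) = real (card (X - Y)) - real (card (Y - X))"
    if "finite X" "finite Y" for X Y :: "nat set"
  proof -
    have "card X = card (X \<inter> Y) + card (X - Y)" "card Y = card (X \<inter> Y) + card (Y - X)"
      using that card_Int_Diff[of X Y] card_Int_Diff[of Y X] by (simp_all add: Int_commute)
    then show ?thesis by simp
  qed
  have \<Delta>: "\<Delta> \<le> dr + dc"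
    unfolding \<Delta>_def dr_def dc_def
      card_diff[OF p(5) c(5), symmetric] card_diff[OF p(6) c(6), symmetric]
    by (rule penalty_difference_le[OF cand ov])
  have D: "Tr + Tc \<le> D"
    using one_minus_overlap_ge[OF p(5,6) c(5,6) ov] by (simp add: D_def Tr_def Tc_def)
  have "{\<omega> \<in> space P. G * D \<le> noise I J \<omega> - noise A B \<omega> + \<Delta>}
      \<subseteq> {\<omega> \<in> space P. G / 4 * (G * D - \<Delta>) \<le> G / 4 * (noise I J \<omega> - noise A B \<omega>)}"
    using G0 by (auto intro!: mult_left_mono)
  then have "prob {\<omega> \<in> space P. G * D \<le> noise I J \<omega> - noise A B \<omega> + \<Delta>}
      \<le> prob {\<omega> \<in> space P. G / 4 * (G * D - \<Delta>) \<le> G / 4 * (noise I J \<omega> - noise A B \<omega>)}"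
    by (rule finite_measure_mono) measurable
  also have "\<dots> \<le> exp ((G / 4)\<^sup>2 * D - G / 4 * (G * D - \<Delta>))"
    unfolding D_def by (rule noise_difference_tail[OF cand])
  also have "\<dots> = exp (G / 4 * \<Delta> - 3/16 * G\<^sup>2 * D)"
    by (simp add: power2_eq_square field_simps)
  also have "\<dots> \<le> exp (- (21/20) * (card (A - I) * ln (real (card A)) + card (I - A) * ln (real M - real (card A)))
      + - (21/20) * (card (B - J) * ln (real (card B)) + card (J - B) * ln (real N - real (card B))))"
  proof -
    have "G / 4 * \<Delta> \<le> G / 4 * (dr + dc)" using \<Delta> G0 by (intro mult_left_mono) auto
    moreover have "3/16 * G\<^sup>2 * (Tr + Tc) \<le> 3/16 * G\<^sup>2 * D" using D by (intro mult_left_mono) auto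
    ultimately have "G / 4 * \<Delta> - 3/16 * G\<^sup>2 * D \<le> - (3/16 * G\<^sup>2 * Tr - G / 4 * dr) + - (3/16 * G\<^sup>2 * Tc - G / 4 * dc)"
      unfolding distrib_left by linarith
    then show ?thesis using exponent unfolding exp_le_cancel_iff by linarith
  qed
  also have "\<dots> = symm_diff_weight A I M * symm_diff_weight B J N"
  proof -
    have rate: "exp (- (21/20) * (card (S - K) * ln (real (card S)) + card (K - S) * ln (real n - real (card S)))) = symm_diff_weight S K n"
      if "2 \<le> card S" "4 * card S \<le> n" for S K n
    proof -
      have pow: "exp (real k * ((-21/20) * ln z)) = (z powr (-21/20)) ^ k" if "0 < z" for k and z :: real
        unfolding exp_of_nat_mult using that by (simp add: powr_def)
      have "- (21/20) * (card (S - K) * ln (real (card S)) + card (K - S) * ln (real n - real (card S)))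
        = real (card (S - K)) * ((-21/20) * ln (real (card S))) + real (card (K - S)) * ((-21/20) * ln (real n - real (card S)))"
        by (simp add: algebra_simps)
      also have "exp \<dots> = symm_diff_weight S K n"
        unfolding exp_add symm_diff_weight_def using that by (subst (1 2) pow) auto
      finally show ?thesis .
    qed
    show ?thesis unfolding exp_add rate[OF A(2,3)] rate[OF B(2,3)] ..
  qed
  finally show ?thesis by (simp add: G_def D_def \<Delta>_def)
qed

text \<open>
  The subtracted \<open>1\<close> is the weight of the planted block itself, which is not a competitor.
\<close>

definition near_error :: real where
  "near_error = exp (real (card A) powr (-1/20) + (real M - real (card A)) powr (-1/20)
     + (real (card B) powr (-1/20) + (real N - real (card B)) powr (-1/20))) - 1"

lemma sum_symm_diff_weight_candidates_le:
  assumes "T \<subseteq> candidates - {(A, B)}"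
  shows "(\<Sum>(I, J)\<in>T. symm_diff_weight A I M * symm_diff_weight B J N) \<le> near_error"
proof -
  let ?f = "\<lambda>(I, J). symm_diff_weight A I M * symm_diff_weight B J N"
  have nonneg: "0 \<le> symm_diff_weight S I n" for S I n by (simp add: symm_diff_weight_def)
  have all: "sum ?f (Pow {1..M} \<times> Pow {1..N}) \<le> near_error + 1"
    unfolding sum.cartesian_product[symmetric] sum_product[symmetric] near_error_def
    using mult_mono[OF sum_symm_diff_weight_le[OF A] sum_symm_diff_weight_le[OF B]] nonneg
    by (simp add: exp_add sum_nonneg)
  have "insert (A, B) T \<subseteq> Pow {1..M} \<times> Pow {1..N}"
    using assms A(1) B(1) by (auto simp: candidates_def)
  then have "sum ?f (insert (A, B) T) \<le> sum ?f (Pow {1..M} \<times> Pow {1..N})"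
    by (intro sum_mono2) (auto simp: nonneg)
  moreover have "finite T" using finite_subset[OF assms] finite_candidates by simp
  moreover have "(A, B) \<notin> T" using assms by auto
  ultimately show ?thesis using all by (simp add: symm_diff_weight_def)
qed

text \<open>
  A level of exactly \<open>\<lambda>\<close> would give a total of \<open>1\<close> in the union bound. The additional \<open>1\<close> gains
  the factor \<open>exp (- \<lambda>)\<close>, and \<open>\<lambda> \<ge> \<surd>(2 ln (MN))\<close> for every block.
\<close>

lemma uniform_noise_bound:
  "prob (\<Union>(I, J)\<in>candidates. {\<omega> \<in> space P. scan_penalty M N (card I) (card J) + 1 \<le> noise I J \<omega>})
     \<le> exp (- sqrt (2 * ln (real M * real N)))"
proof -
  let ?pen = "\<lambda>I J. scan_penalty M N (card I) (card J)"
  let ?E = "\<lambda>(I, J). {\<omega> \<in> space P. ?pen I J + 1 \<le> noise I J \<omega>}"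
  let ?w = "\<lambda>U I. 1 / (real (card U) * real (card U choose card I))"
  let ?t = "exp (- sqrt (2 * ln (real M * real N)))"
  have single: "prob (?E (I, J)) \<le> ?t * (?w {1..M} I * ?w {1..N} J)" if cand: "(I, J) \<in> candidates" for I J
  proof -
    note c = candidatesD[OF cand] note pen = scan_penalty_bounds[OF M_N_pos c(8,9)]
    define l where "l = ?pen I J"
    have "0 \<le> l" using scan_penalty_nonneg[OF M_N_pos c(8,9)] by (simp add: l_def)
    have "prob (?E (I, J)) \<le> prob {\<omega> \<in> space P. (l + 1) * (l + 1) \<le> (l + 1) * noise I J \<omega>}"
      using \<open>0 \<le> l\<close> by (intro finite_measure_mono) (auto simp: l_def intro!: mult_left_mono)
    also have "\<dots> \<le> exp ((l + 1)\<^sup>2 / 2 - (l + 1) * (l + 1))" by (rule noise_tail[OF cand])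
    also have "\<dots> \<le> exp (- l + - l\<^sup>2 / 2)" by (simp add: power2_eq_square algebra_simps)
    also have "\<dots> = exp (- l) * exp (- l\<^sup>2 / 2)" by (rule exp_add)
    also have "\<dots> = exp (- l) * (?w {1..M} I * ?w {1..N} J)" using pen(1) by (simp add: l_def)
    also have "\<dots> \<le> ?t * (?w {1..M} I * ?w {1..N} J)"
      using pen(2) by (intro mult_right_mono) (auto simp: l_def)
    finally show ?thesis .
  qed
  have "prob (\<Union>x\<in>candidates. ?E x) \<le> (\<Sum>x\<in>candidates. prob (?E x))"
    by (intro finite_measure_subadditive_finite finite_candidates) (auto simp: split_beta)
  also have "\<dots> \<le> (\<Sum>(I, J)\<in>candidates. ?t * (?w {1..M} I * ?w {1..N} J))"
    using single by (intro sum_mono) auto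
  also have "candidates = (Pow {1..M} - {{}}) \<times> (Pow {1..N} - {{}})" by (auto simp: candidates_def)
  also have "(\<Sum>(I, J)\<in>(Pow {1..M} - {{}}) \<times> (Pow {1..N} - {{}}). ?t * (?w {1..M} I * ?w {1..N} J))
      = ?t * ((\<Sum>I\<in>Pow {1..M} - {{}}. ?w {1..M} I) * (\<Sum>J\<in>Pow {1..N} - {{}}. ?w {1..N} J))"
    by (subst sum_product, subst sum.cartesian_product, subst sum_distrib_left) (simp only: case_prod_unfold)
  also have "\<dots> = ?t" using M_N_pos by (subst (1 2) sum_inverse_binomial_subsets) auto
  finally show ?thesis by (simp add: \<open>candidates = _\<close>)
qed

text \<open>
  The three error terms belong to the near competitors, to the noise of the far ones, and to the noise of the
  planted block, for which \<open>u\<close> is the tolerated deviation.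
\<close>

theorem recovery_probability:
  assumes strong: "5 * sqrt (real (card A) * (ln (real M - real (card A)) + ln (real (card A)))) \<le> strength"
      "5 * sqrt (real (card B) * (ln (real N - real (card B)) + ln (real (card B)))) \<le> strength"
      "scan_penalty M N (card A) (card B) + 1 + u \<le> strength / 5"
    and u: "0 \<le> u"
  shows "1 - near_error - exp (- sqrt (2 * ln (real M * real N))) - exp (- u\<^sup>2 / 2)
    \<le> prob {\<omega> \<in> space P. scan_estimator M N (planted_matrix \<theta> A B (\<lambda>ij. e ij \<omega>)) = (A, B)}"
    (is "_ \<le> prob ?recovered")
proof -
  let ?pen = "\<lambda>I J. scan_penalty M N (card I) (card J)"
  let ?crit = "\<lambda>\<omega>. scan_criterion M N (planted_matrix \<theta> A B (\<lambda>ij. e ij \<omega>))"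
  define T where "T = {(I, J) \<in> candidates - {(A, B)}. 4/5 \<le> overlap A B I J}"
  define near where "near = (\<lambda>(I, J). {\<omega> \<in> space P.
    strength * (1 - overlap A B I J) \<le> noise I J \<omega> - noise A B \<omega> + (?pen A B - ?pen I J)})"
  define E1 where "E1 = (\<Union>x\<in>T. near x)"
  define E2 where "E2 = (\<Union>(I, J)\<in>candidates. {\<omega> \<in> space P. ?pen I J + 1 \<le> noise I J \<omega>})"
  define E3 where "E3 = {\<omega> \<in> space P. u * u \<le> - u * noise A B \<omega>}"
  have finT: "finite T" by (rule finite_subset[OF _ finite_candidates]) (auto simp: T_def)
  have near_sets: "near x \<in> sets P" for x unfolding near_def split_beta by measurable
  have sets: "E1 \<in> sets P" "E2 \<in> sets P" "E3 \<in> sets P"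
    unfolding E1_def E2_def E3_def using finT finite_candidates near_sets
    by (auto intro!: sets.finite_UN simp: split_beta)
  have "prob E1 \<le> (\<Sum>x\<in>T. prob (near x))"
    unfolding E1_def using finT near_sets by (intro finite_measure_subadditive_finite) auto
  also have "\<dots> \<le> (\<Sum>(I, J)\<in>T. symm_diff_weight A I M * symm_diff_weight B J N)"
    using near_competitor_tail[OF strong(1,2)] by (intro sum_mono) (auto simp: T_def near_def)
  also have "\<dots> \<le> near_error" by (rule sum_symm_diff_weight_candidates_le) (auto simp: T_def)
  finally have P1: "prob E1 \<le> near_error" .
  have P2: "prob E2 \<le> exp (- sqrt (2 * ln (real M * real N)))"
    unfolding E2_def by (rule uniform_noise_bound)
  have P3: "prob E3 \<le> exp (- u\<^sup>2 / 2)"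
    using noise_tail[OF planted_candidate, of "u * u" "- u"] by (simp add: E3_def power2_eq_square)
  have recovered: "space P - (E1 \<union> E2 \<union> E3) \<subseteq> ?recovered"
  proof (intro subsetI CollectI conjI)
    fix \<omega> assume \<omega>: "\<omega> \<in> space P - (E1 \<union> E2 \<union> E3)"
    then show "\<omega> \<in> space P" by simp
    have better: "?crit \<omega> (I, J) < ?crit \<omega> (A, B)" if cand: "(I, J) \<in> candidates" and "(I, J) \<noteq> (A, B)" for I J
    proof -
      have self: "overlap A B A B = 1"
        using candidatesD[OF planted_candidate] by (intro overlap_self)
      have "noise I J \<omega> - noise A B \<omega> + (?pen A B - ?pen I J) < strength * (1 - overlap A B I J)"
      proof (cases "4/5 \<le> overlap A B I J")
        case True
        then have "\<omega> \<notin> near (I, J)" using \<omega> that unfolding E1_def T_def by blast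
        then show ?thesis using \<omega> by (simp add: near_def not_le)
      next
        case False
        \<comment> \<open>far competitors: \<open>G (1 - \<rho>) \<ge> G/5\<close> covers the penalty and both noise terms\<close>
        have "0 \<le> ?pen A B"
          using M_N_pos candidatesD(8,9)[OF planted_candidate] by (rule scan_penalty_nonneg)
        then have "0 \<le> strength" using strong(3) u by linarith
        then have "strength * (1/5) \<le> strength * (1 - overlap A B I J)"
          using False by (intro mult_left_mono) auto
        moreover have "noise I J \<omega> < ?pen I J + 1" 
        proof (rule ccontr)
          assume "\<not> ?thesis"
          then have "\<omega> \<in> E2" unfolding E2_def using \<omega> cand by (intro UN_I[of "(I, J)"]) auto
          then show False using \<omega> by simp
        qed
        moreover have "- u \<le> noise A B \<omega>"
        proof (rule ccontr)
          assume "\<not> ?thesis"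
          then have "u * u \<le> u * - noise A B \<omega>" using u by (intro mult_left_mono) auto
          then show False using \<omega> by (auto simp: E3_def)
        qed
        ultimately show ?thesis using strong(3) by linarith
      qed
      moreover have "strength * (1 - overlap A B I J) = strength - strength * overlap A B I J"
        by (simp add: right_diff_distrib)
      ultimately show ?thesis
        unfolding criterion_eq[OF cand] criterion_eq[OF planted_candidate] self by linarith
    qed
    show "scan_estimator M N (planted_matrix \<theta> A B (\<lambda>ij. e ij \<omega>)) = (A, B)"
      unfolding scan_estimator_def candidates_def[symmetric] arg_max_on_def
    proof (rule arg_maxI[of _ "(A, B)"])
      show "(A, B) \<in> candidates" by (rule planted_candidate)
      show "\<not> ?crit \<omega> (A, B) < ?crit \<omega> y" if "y \<in> candidates" for y
        using better that less_asym by (cases y) fastforce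
      show "x = (A, B)" if "x \<in> candidates" "\<forall>y. y \<in> candidates \<longrightarrow> \<not> ?crit \<omega> x < ?crit \<omega> y" for x
        using better that planted_candidate by (cases x) blast
    qed
  qed
  have "?recovered \<in> sets P"
    unfolding scan_estimator_def candidates_def[symmetric]
  proof -
    have "{\<omega> \<in> space P. arg_max_on (\<lambda>x. ?crit \<omega> x) candidates = (A, B)} \<in> sets P"
    proof (rule measurable_arg_max_on[OF finite_candidates])
      fix x assume "x \<in> candidates"
      then show "(\<lambda>\<omega>. ?crit \<omega> x) \<in> borel_measurable P"
        by (cases x) (simp add: criterion_eq)
    qed
    then show "{\<omega> \<in> space P. arg_max_on (?crit \<omega>) candidates = (A, B)} \<in> sets P" by simp
  qed
  then have "prob (space P - (E1 \<union> E2 \<union> E3)) \<le> prob ?recovered"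
    using recovered by (intro finite_measure_mono)
  moreover have "prob (space P - (E1 \<union> E2 \<union> E3)) = 1 - prob (E1 \<union> E2 \<union> E3)"
    using sets by (intro prob_compl) auto
  moreover have "prob (E1 \<union> E2 \<union> E3) \<le> prob (E1 \<union> E2) + prob E3" "prob (E1 \<union> E2) \<le> prob E1 + prob E2"
    using sets by (auto intro!: measure_Un_le)
  ultimately show ?thesis using P1 P2 P3 by linarith
qed

end

section \<open>The asymptotic regime\<close>

text \<open>
  With \<open>r = C / (C - 1) \<ge> 1\<close>, both powers in the equation are at least \<open>r\<close>, so \<open>C \<ge> 4 r\<close>, that is
  \<open>C - 1 \<ge> 4\<close>.
\<close>

lemma threshold_const_ge_5:
  assumes "is_threshold_const C"
  shows "5 \<le> C"
proof -
  define r where "r = C / (C - 1)"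
  have C: "1 < C" "C = 2 * (r powr (3/2) + r powr (5/4))"
    using assms by (auto simp: is_threshold_const_def r_def)
  have "1 \<le> r" using C(1) by (simp add: r_def)
  then have "r powr 1 \<le> r powr (3/2)" "r powr 1 \<le> r powr (5/4)"
    by (intro powr_mono; simp)+
  then have "4 * r \<le> C" using C(2) \<open>1 \<le> r\<close> by simp
  then have "4 * C \<le> C * (C - 1)" using C(1) by (simp add: r_def field_simps)
  then show ?thesis using C(1) by (simp add: mult.commute)
qed

text \<open>
  The three terms of the maximum, multiplied by \<open>\<surd>(mn)\<close>, are the three quantities with which the strength is
  compared in \<open>recovery_probability\<close>. In the last one, the factor \<open>r\<close> leaves room
  for the noise.
\<close>

lemma signal_threshold_strength:
  assumes C: "5 \<le> C" and r: "1 \<le> r" and m: "2 \<le> m" "4 * m \<le> M" and n: "2 \<le> n" "4 * n \<le> N"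
    and \<theta>: "r * signal_threshold C M N m n \<le> \<theta>"
  shows "5 * sqrt (real m * (ln (real M - real m) + ln (real m))) \<le> \<theta> * sqrt (real m * real n)"
    and "5 * sqrt (real n * (ln (real N - real n) + ln (real n))) \<le> \<theta> * sqrt (real m * real n)"
    and "r * scan_penalty M N m n \<le> \<theta> * sqrt (real m * real n) / 5"
proof -
  define a where "a = sqrt ((ln (real M - real m) + ln (real m)) / real n)"
  define b where "b = sqrt ((ln (real N - real n) + ln (real n)) / real m)"
  define c where "c = scan_penalty M N m n / sqrt (real m * real n)"
  define s where "s = sqrt (real m * real n)"
  have s: "0 < s" using m n by (simp add: s_def)
  have "0 \<le> scan_penalty M N m n" using m n by (intro scan_penalty_nonneg) auto
  then have nonneg: "0 \<le> a" "0 \<le> b" "0 \<le> c" using m n by (auto simp: a_def b_def c_def)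
  have thr: "signal_threshold C M N m n = C * Max {a, b, c}"
    by (simp add: signal_threshold_def a_def b_def c_def)
  have bound: "5 * (r * (z * s)) \<le> \<theta> * s" if "z \<in> {a, b, c}" for z
  proof -
    have z: "0 \<le> z" "z \<le> Max {a, b, c}" using that nonneg by (auto intro!: Max_ge)
    have "5 * z \<le> C * Max {a, b, c}" using C z by (intro mult_mono) auto
    then have "r * (5 * z) \<le> r * (C * Max {a, b, c})" using r by (intro mult_left_mono) auto
    also have "\<dots> \<le> \<theta>" using \<theta> by (simp add: thr)
    finally have "r * (5 * z) * s \<le> \<theta> * s" using s by (intro mult_right_mono) auto
    then show ?thesis by (simp add: mult_ac)
  qed
  have bound1: "5 * (z * s) \<le> \<theta> * s" if "z \<in> {a, b, c}" for z
  proof -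
    have "0 \<le> z * s" using that nonneg s by auto
    then have "1 * (z * s) \<le> r * (z * s)" using r by (intro mult_right_mono) auto
    then show ?thesis using bound[OF that] by linarith
  qed
  have "a * s = sqrt (real m * (ln (real M - real m) + ln (real m)))"
    unfolding a_def s_def real_sqrt_mult[symmetric] using n by (simp add: mult.commute)
  then show "5 * sqrt (real m * (ln (real M - real m) + ln (real m))) \<le> \<theta> * sqrt (real m * real n)"
    using bound1[of a] by (simp add: s_def)
  have "b * s = sqrt (real n * (ln (real N - real n) + ln (real n)))"
    unfolding b_def s_def real_sqrt_mult[symmetric] using m by (simp add: mult.commute)
  then show "5 * sqrt (real n * (ln (real N - real n) + ln (real n))) \<le> \<theta> * sqrt (real m * real n)"
    using bound1[of b] by (simp add: s_def)
  have "c * s = scan_penalty M N m n" using m n by (simp add: c_def s_def)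
  then show "r * scan_penalty M N m n \<le> \<theta> * sqrt (real m * real n) / 5"
    using bound[of c] by (simp add: s_def)
qed

theorem theorem2:
  fixes P :: "nat \<Rightarrow> 'a measure"
    and M N m n :: "nat \<Rightarrow> nat"
    and I J :: "nat \<Rightarrow> nat set"
    and \<theta> :: "nat \<Rightarrow> real"
    and \<epsilon> :: "nat \<Rightarrow> nat \<times> nat \<Rightarrow> 'a \<Rightarrow> real"
    and C :: real
  assumes "\<And>k. prob_space (P k)"
    and "\<And>k. prob_space.indep_vars (P k) (\<lambda>_. borel) (\<epsilon> k) ({1..M k} \<times> {1..N k})"
    and "\<And>k ij. ij \<in> {1..M k} \<times> {1..N k} \<Longrightarrow>
           distributed (P k) lborel (\<epsilon> k ij) std_normal_density"
    and "\<And>k. I k \<subseteq> {1..M k}" and "\<And>k. card (I k) = m k"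
    and "\<And>k. J k \<subseteq> {1..N k}" and "\<And>k. card (J k) = n k"
    and "\<And>k. \<theta> k > 0"
    and "filterlim M at_top sequentially" and "filterlim N at_top sequentially"
    and "filterlim m at_top sequentially" and "filterlim n at_top sequentially"
    and "(\<lambda>k. real (max (m k) (n k)) / real (min (M k) (N k))) \<longlonglongrightarrow> 0"
    and "is_threshold_const C"
    and "liminf (\<lambda>k. ereal (\<theta> k / signal_threshold C (M k) (N k) (m k) (n k))) > 1"
  shows "(\<lambda>k. measure (P k) {\<omega> \<in> space (P k).
            scan_estimator (M k) (N k) (planted_matrix (\<theta> k) (I k) (J k) (\<lambda>ij. \<epsilon> k ij \<omega>))
              = (I k, J k)}) \<longlonglongrightarrow> 1"
proof -
  note limits = assms(9-12)
  obtain r where r: "1 < r"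
    and r_lim: "ereal r < liminf (\<lambda>k. ereal (\<theta> k / signal_threshold C (M k) (N k) (m k) (n k)))"
    using ereal_dense2[OF assms(15)] by auto
  have C: "5 \<le> C" by (rule threshold_const_ge_5[OF assms(14)])
  define l where "l k = sqrt (2 * ln (real (M k) * real (N k)))" for k
  \<comment> \<open>the part of \<open>r \<lambda> - \<lambda>\<close> that remains for the noise of the planted block\<close>
  define u where "u k = (r - 1) * l k - 1" for k
  define err where "err k = exp (real (m k) powr (-1/20) + (real (M k) - real (m k)) powr (-1/20)
     + (real (n k) powr (-1/20) + (real (N k) - real (n k)) powr (-1/20))) - 1
     + exp (- l k) + exp (- (u k)\<^sup>2 / 2)" for k

  have ev_pos: "\<forall>\<^sub>F k in sequentially. 1 \<le> M k \<and> 1 \<le> N k \<and> 2 \<le> m k \<and> 2 \<le> n k"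
    using limits by (simp add: filterlim_at_top eventually_conj_iff)
  have "\<forall>\<^sub>F k in sequentially. real (max (m k) (n k)) / real (min (M k) (N k)) < 1/4"
    using order_tendstoD(2)[OF assms(13), of "1/4"] by simp
  with ev_pos have ev_sizes: "\<forall>\<^sub>F k in sequentially. 4 * m k \<le> M k \<and> 4 * n k \<le> N k"
  proof eventually_elim
    case (elim k)
    then have "real (4 * max (m k) (n k)) < real (min (M k) (N k))" by (simp add: divide_less_eq)
    then have "4 * max (m k) (n k) < min (M k) (N k)" by (simp only: of_nat_less_iff)
    then show ?case by (simp add: max_def min_def split: if_splits)
  qed

  have real_limits: "filterlim (\<lambda>k. real (M k)) at_top sequentially" "filterlim (\<lambda>k. real (N k)) at_top sequentially"
    "filterlim (\<lambda>k. real (m k)) at_top sequentially" "filterlim (\<lambda>k. real (n k)) at_top sequentially"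
    using limits by (auto intro: filterlim_compose[OF filterlim_real_sequentially])
  have rest_limits: "filterlim (\<lambda>k. real (M k) - real (m k)) at_top sequentially"
    "filterlim (\<lambda>k. real (N k) - real (n k)) at_top sequentially"
  proof -
    show "filterlim (\<lambda>k. real (M k) - real (m k)) at_top sequentially"
      by (rule filterlim_at_top_mono[OF real_limits(3)]) (use ev_sizes in eventually_elim, simp)
    show "filterlim (\<lambda>k. real (N k) - real (n k)) at_top sequentially"
      by (rule filterlim_at_top_mono[OF real_limits(4)]) (use ev_sizes in eventually_elim, simp)
  qed
  have l_lim: "filterlim l at_top sequentially"
    unfolding l_def[abs_def]
    by (intro filterlim_compose[OF sqrt_at_top] filterlim_tendsto_pos_mult_at_top[OF tendsto_const]
      filterlim_compose[OF ln_at_top] filterlim_at_top_mult_at_top real_limits) simp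
  have u_lim: "filterlim u at_top sequentially"
  proof -
    have "filterlim (\<lambda>k. - 1 + (r - 1) * l k) at_top sequentially"
      using r by (intro filterlim_tendsto_add_at_top[OF tendsto_const] filterlim_tendsto_pos_mult_at_top[OF tendsto_const _ l_lim]) simp
    then show ?thesis by (simp add: u_def[abs_def] algebra_simps)
  qed
  have err_lim: "err \<longlonglongrightarrow> 0"
  proof -
    have "(\<lambda>k. real (m k) powr (-1/20)) \<longlonglongrightarrow> 0" "(\<lambda>k. real (n k) powr (-1/20)) \<longlonglongrightarrow> 0"
      "(\<lambda>k. (real (M k) - real (m k)) powr (-1/20)) \<longlonglongrightarrow> 0" "(\<lambda>k. (real (N k) - real (n k)) powr (-1/20)) \<longlonglongrightarrow> 0"
      using real_limits rest_limits by (auto intro!: tendsto_neg_powr)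
    moreover have "(\<lambda>k. exp (- l k)) \<longlonglongrightarrow> 0"
      using filterlim_compose[OF exp_at_bot] l_lim filterlim_uminus_at_top by blast
    moreover have "(\<lambda>k. exp (- (u k)\<^sup>2 / 2)) \<longlonglongrightarrow> 0"
    proof -
      have "filterlim (\<lambda>k. 1/2 * (u k * u k)) at_top sequentially"
        by (intro filterlim_tendsto_pos_mult_at_top[OF tendsto_const] filterlim_at_top_mult_at_top u_lim) simp
      then have "filterlim (\<lambda>k. - (1/2 * (u k * u k))) at_bot sequentially"
        by (simp add: filterlim_uminus_at_top[symmetric])
      from filterlim_compose[OF exp_at_bot this] show ?thesis by (simp add: power2_eq_square)
    qed
    ultimately have "err \<longlonglongrightarrow> exp (0 + 0 + (0 + 0)) - 1 + 0 + 0"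
      unfolding err_def[abs_def] by (intro tendsto_intros)
    then show ?thesis by simp
  qed

  have ev_signal: "\<forall>\<^sub>F k in sequentially. r < \<theta> k / signal_threshold C (M k) (N k) (m k) (n k)"
    using less_LiminfD[OF r_lim] by simp
  have ev_u: "\<forall>\<^sub>F k in sequentially. 0 \<le> u k" using u_lim by (simp add: filterlim_at_top)
  have lower: "\<forall>\<^sub>F k in sequentially. 1 - err k \<le> measure (P k) {\<omega> \<in> space (P k).
      scan_estimator (M k) (N k) (planted_matrix (\<theta> k) (I k) (J k) (\<lambda>ij. \<epsilon> k ij \<omega>)) = (I k, J k)}"
    using ev_pos ev_sizes ev_signal ev_u
  proof eventually_elim
    case (elim k)
    let ?t = "signal_threshold C (M k) (N k) (m k) (n k)"
    interpret planted_submatrix "P k" "M k" "N k" "I k" "J k" "\<theta> k" "\<epsilon> k"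
      using assms(1-7) elim by (intro planted_submatrix.intro planted_submatrix_axioms.intro) auto
    have "0 < ?t"
    proof (rule ccontr)
      assume "\<not> 0 < ?t"
      then have "\<theta> k / ?t \<le> 0" using assms(8)[of k] by (simp add: divide_nonneg_nonpos)
      then show False using elim r by linarith
    qed
    then have "r * ?t \<le> \<theta> k" using elim by (simp add: field_simps)
    note bounds = signal_threshold_strength[OF C less_imp_le[OF r] _ _ _ _ this]
    have pen: "l k \<le> scan_penalty (M k) (N k) (m k) (n k)"
      unfolding l_def using elim by (intro scan_penalty_bounds(2)) auto
    have "(r - 1) * l k \<le> (r - 1) * scan_penalty (M k) (N k) (m k) (n k)"
      using pen r by (intro mult_left_mono) auto
    then have u_le: "scan_penalty (M k) (N k) (m k) (n k) + 1 + u k \<le> r * scan_penalty (M k) (N k) (m k) (n k)"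
      by (simp add: u_def left_diff_distrib)
    have "1 - near_error - exp (- sqrt (2 * ln (real (M k) * real (N k)))) - exp (- (u k)\<^sup>2 / 2)
      \<le> prob {\<omega> \<in> space (P k). scan_estimator (M k) (N k) (planted_matrix (\<theta> k) (I k) (J k) (\<lambda>ij. \<epsilon> k ij \<omega>)) = (I k, J k)}"
      using elim bounds u_le by (intro recovery_probability) (auto simp: strength_def assms(5,7))
    then show ?case by (simp add: err_def near_error_def assms(5,7) l_def algebra_simps)
  qed
  show ?thesis
  proof (rule tendsto_sandwich[OF lower])
    show "(\<lambda>k. 1 - err k) \<longlonglongrightarrow> 1" using tendsto_diff[OF tendsto_const err_lim, of 1] by simp
    show "(\<lambda>k. 1) \<longlonglongrightarrow> (1::real)" by simp
    show "\<forall>\<^sub>F k in sequentially. measure (P k) {\<omega> \<in> space (P k).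
      scan_estimator (M k) (N k) (planted_matrix (\<theta> k) (I k) (J k) (\<lambda>ij. \<epsilon> k ij \<omega>)) = (I k, J k)} \<le> 1"
      by (intro always_eventually allI prob_space.prob_le_1 assms(1))
  qed
qed

end
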